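(* Let $k$ be a positive integer. Any co-$k$-threshold hypergraph is Laplacian $r$-integral for some $r\in\mathbb{Q}$; that is, for every co-$k$-threshold hypergraph $G$ there exists $r\in\mathbb{Q}$ such that every eigenvalue of $L_G$ is of the form $rp$ with $p\in\mathbb{Z}$.
   Context: A (finite) hypergraph $G=(V,E)$ consists of a nonempty finite vertex set $V$ and a set $E$ of subsets of $V$ (hyperedges), with $|e|\ge 2$ for all $e\in E$. It is $m$-uniform if $|e|=m$ for all $e\in E$. For $v\in V$ let $E_v=\{e\in E: v\in e\}$. The Laplacian $L_G:\mathbb{R}^V\to\mathbb{R}^V$ is $$(L_Gf)(v)=\sum_{e\in E_v}\frac{1}{|e|-1}\sum_{u\in e}\bigl(f(v)-f(u)\bigr),\qquad v\in V.$$ A hypergraph $G$ is Laplacian $r$-integral if all eigenvalues of $L_G$ are integer multiples of the real number $r$. For a positive integer $k$, applying $k$-domination to a hypergraph $(V,E)$ means adding a set $S$ of $k$ new vertices ($S\cap V=\emptyset$), producing the hypergraph with vertex set $V\cup S$ and hyperedge set $E\cup\{S\cup\{v\}: v\in V\}$. Adding an isolated vertex means adding one new vertex without changing the hyperedge set. A $k$-threshold hypergraph is a hypergraph obtained from a single vertex by repeatedly adding an isolated vertex or applying $k$-domination, with the same fixed $k$ in every domination; it is $(k+1)$-uniform. The complement of an $m$-uniform hypergraph $(V,E)$ is the hypergraph with vertex set $V$ whose hyperedges are the $m$-element subsets of $V$ not in $E$. The class of co-$k$-threshold hypergraphs is defined recursively by: (i) any $k$-threshold hypergraph is a co-$k$-threshold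 hypergraph; (ii) the complement of a co-$k$-threshold hypergraph is a co-$k$-threshold hypergraph (complements being taken as $(k+1)$-uniform hypergraphs, i.e. $m=k+1$); (iii) the union (of vertex sets and of hyperedge sets) of two vertex-disjoint co-$k$-threshold hypergraphs is a co-$k$-threshold hypergraph. *)

theory Defs
  imports Complex_Main
begin

text \<open>
  A hypergraph is given by its vertex set \<open>V\<close> and its hyperedge set \<open>E\<close>, as two separate
  arguments.
\<close>

definition hypergraph :: "'a set \<Rightarrow> 'a set set \<Rightarrow> bool" where
  "hypergraph V E \<longleftrightarrow> finite V \<and> V \<noteq> {} \<and> (\<forall>e\<in>E. e \<subseteq> V \<and> 2 \<le> card e)"

definition uniform :: "nat \<Rightarrow> 'a set set \<Rightarrow> bool" where
  "uniform m E \<longleftrightarrow> (\<forall>e\<in>E. card e = m)"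

definition hyperedges_at :: "'a set set \<Rightarrow> 'a \<Rightarrow> 'a set set" where
  "hyperedges_at E v = {e \<in> E. v \<in> e}"

definition laplacian :: "'a set set \<Rightarrow> ('a \<Rightarrow> real) \<Rightarrow> 'a \<Rightarrow> real" where
  "laplacian E f v =
     (\<Sum>e\<in>hyperedges_at E v. 1 / (real (card e) - 1) * (\<Sum>u\<in>e. f v - f u))"

text \<open>
  Elements of \<open>\<real>\<^sup>V\<close> are represented by total functions, of which only the values on \<open>V\<close> matter:
  for a hypergraph, \<open>laplacian E f v\<close> with \<open>v \<in> V\<close> depends only on the restriction of \<open>f\<close>
  to \<open>V\<close> (lemma \<open>laplacian_cong\<close>). So a vector is nonzero iff it is nonzero somewhere on \<open>V\<close>.
\<close>

definition laplacian_eigenvalue :: "'a set \<Rightarrow> 'a set set \<Rightarrow> real \<Rightarrow> bool" where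
  "laplacian_eigenvalue V E \<mu> \<longleftrightarrow>
     (\<exists>f. (\<exists>v\<in>V. f v \<noteq> 0) \<and> (\<forall>v\<in>V. laplacian E f v = \<mu> * f v))"

definition laplacian_integral :: "real \<Rightarrow> 'a set \<Rightarrow> 'a set set \<Rightarrow> bool" where
  "laplacian_integral r V E \<longleftrightarrow>
     (\<forall>\<mu>. laplacian_eigenvalue V E \<mu> \<longrightarrow> (\<exists>p::int. \<mu> = r * of_int p))"

inductive threshold_hypergraph :: "nat \<Rightarrow> 'a set \<Rightarrow> 'a set set \<Rightarrow> bool" for k :: nat where
  single: "threshold_hypergraph k {v} {}"
| isolated: "threshold_hypergraph k (insert v V) E"
    if "threshold_hypergraph k V E" and "v \<notin> V"
| domination: "threshold_hypergraph k (V \<union> S) (E \<union> {S \<union> {v} | v. v \<in> V})"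
    if "threshold_hypergraph k V E" and "finite S" and "card S = k" and "S \<inter> V = {}"

definition complement_hyperedges :: "nat \<Rightarrow> 'a set \<Rightarrow> 'a set set \<Rightarrow> 'a set set" where
  "complement_hyperedges m V E = {e. e \<subseteq> V \<and> card e = m \<and> e \<notin> E}"

inductive co_threshold_hypergraph :: "nat \<Rightarrow> 'a set \<Rightarrow> 'a set set \<Rightarrow> bool" for k :: nat where
  threshold: "co_threshold_hypergraph k V E"
    if "threshold_hypergraph k V E"
| complement: "co_threshold_hypergraph k V (complement_hyperedges (k + 1) V E)"
    if "co_threshold_hypergraph k V E"
| union: "co_threshold_hypergraph k (V \<union> V') (E \<union> E')"
    if "co_threshold_hypergraph k V E" and "co_threshold_hypergraph k V' E'" and "V \<inter> V' = {}"

lemma laplacian_cong: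
  assumes "hypergraph V E" and "v \<in> V" and "\<And>u. u \<in> V \<Longrightarrow> f u = g u"
  shows "laplacian E f v = laplacian E g v"
proof -
  have "(\<Sum>u\<in>e. f v - f u) = (\<Sum>u\<in>e. g v - g u)" if "e \<in> hyperedges_at E v" for e
  proof (rule sum.cong)
    fix u assume "u \<in> e"
    with that have "u \<in> V"
      using assms(1) by (auto simp: hypergraph_def hyperedges_at_def)
    with assms(2,3) show "f v - f u = g v - g u" by simp
  qed simp
  then show ?thesis by (simp add: laplacian_def)
qed

lemma threshold_hypergraph_wf:
  assumes "threshold_hypergraph k V E" and "0 < k"
  shows "hypergraph V E \<and> uniform (k + 1) E"
  using assms
proof (induction rule: threshold_hypergraph.induct)
  case (domination V E S)
  have "card (insert v S) = k + 1" if "v \<in> V" for v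
    using domination.hyps that by (subst card_insert_disjoint) auto
  with domination show ?case
    by (fastforce simp: hypergraph_def uniform_def)
qed (auto simp: hypergraph_def uniform_def)

lemma co_threshold_hypergraph_wf:
  assumes "co_threshold_hypergraph k V E" and "0 < k"
  shows "hypergraph V E \<and> uniform (k + 1) E"
  using assms
proof (induction rule: co_threshold_hypergraph.induct)
  case (threshold V E)
  then show ?case by (rule threshold_hypergraph_wf)
next
  case (complement V E)
  then show ?case by (auto simp: hypergraph_def uniform_def complement_hyperedges_def)
next
  case (union V E V' E')
  then show ?case by (auto simp: hypergraph_def uniform_def)
qed

end

theory Submission
  imports Defs
begin

text \<open>
  The stronger fact behind the theorem is that a single \<open>r\<close> serves all co-\<open>k\<close>-threshold
  hypergraphs: every eigenvalue is an integer multiple of \<open>1 / k\<close>.  This form is stable under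
  each constructor and avoids any search for a common denominator of the spectrum.

  The key is that the values of \<open>L f\<close> sum to zero over the vertex set, so an eigenvector with
  nonzero eigenvalue sums to zero (\<open>eigenvector_sum_eq_0\<close>).  In a disjoint union an eigenvector
  restricts to an eigenvector of some part (\<open>laplacian_integral_Un\<close>); adding an isolated vertex
  is a union with a single vertex.

  For complements (\<open>laplacian_integral_complement\<close>), the two Laplacians add up to that of the
  complete uniform hypergraph, which acts on vectors of sum zero as the scalar \<open>N n / k\<close>, where
  \<open>n\<close> is the number of vertices and \<open>N\<close> the number of its hyperedges through two given distinct
  vertices; thus a nonzero eigenvalue \<open>\<mu>\<close> of the complement comes from the eigenvalue
  \<open>N n / k - \<mu>\<close>.

  For a domination of a hypergraph on \<open>n\<close> vertices by \<open>S\<close> (\<open>laplacian_integral_domination\<close>),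
  summing the eigenvalue equation over \<open>S\<close> shows that a nonzero eigenvalue either is \<open>1 + n / k\<close>
  or has only eigenvectors summing to zero on both the old and the new vertices.  The equation then
  decouples, leaving \<open>n (k + 1) / k\<close> and the old eigenvalues shifted by \<open>1\<close>.
\<close>

section \<open>General properties of the Laplacian\<close>

text \<open>
  Each hyperedge contributes the sum of \<open>f v - f u\<close> over all ordered pairs of its vertices,
  which is antisymmetric.
\<close>

lemma sum_laplacian_eq_0:
  assumes "finite V" and "E \<subseteq> Pow V"
  shows "(\<Sum>v\<in>V. laplacian E f v) = 0"
proof -
  have finE: "finite E"
    using assms finite_subset by blast
  let ?g = "\<lambda>e v. 1 / (real (card e) - 1) * (\<Sum>u\<in>e. f v - f u)"
  have "(\<Sum>v\<in>V. laplacian E f v) = (\<Sum>v\<in>V. \<Sum>e | e \<in> E \<and> v \<in> e. ?g e v)"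
    by (simp add: laplacian_def hyperedges_at_def)
  also have "\<dots> = (\<Sum>e\<in>E. \<Sum>v | v \<in> V \<and> v \<in> e. ?g e v)"
    by (rule sum.swap_restrict[OF assms(1) finE])
  also have "\<dots> = (\<Sum>e\<in>E. 0)"
  proof (rule sum.cong)
    fix e assume "e \<in> E"
    then have "{v. v \<in> V \<and> v \<in> e} = e"
      using assms(2) by auto
    then have "(\<Sum>v | v \<in> V \<and> v \<in> e. ?g e v)
        = 1 / (real (card e) - 1) * (\<Sum>v\<in>e. \<Sum>u\<in>e. f v - f u)"
      by (simp add: sum_distrib_left)
    also have "(\<Sum>v\<in>e. \<Sum>u\<in>e. f v - f u) = 0"
      by (simp add: sum_subtractf sum_distrib_left)
    finally show "(\<Sum>v | v \<in> V \<and> v \<in> e. ?g e v) = 0"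
      by simp
  qed simp
  finally show ?thesis
    by simp
qed

lemma eigenvector_sum_eq_0:
  assumes "finite V" and "E \<subseteq> Pow V"
    and "\<forall>v\<in>V. laplacian E f v = \<mu> * f v" and "\<mu> \<noteq> 0"
  shows "sum f V = 0"
proof -
  have "\<mu> * sum f V = (\<Sum>v\<in>V. laplacian E f v)"
    using assms(3) by (simp add: sum_distrib_left)
  then show ?thesis
    using sum_laplacian_eq_0[OF assms(1,2)] assms(4) by simp
qed

lemma laplacian_Un_disjoint:
  assumes "finite E" and "finite E'" and "E \<inter> E' = {}"
  shows "laplacian (E \<union> E') f v = laplacian E f v + laplacian E' f v"
proof -
  have "hyperedges_at (E \<union> E') v = hyperedges_at E v \<union> hyperedges_at E' v"
    by (auto simp: hyperedges_at_def)
  then show ?thesis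
    using assms unfolding laplacian_def
    by (simp only:) (rule sum.union_disjoint, auto simp: hyperedges_at_def)
qed

lemma laplacian_Un_not_incident:
  assumes "\<And>e. e \<in> E' \<Longrightarrow> v \<notin> e"
  shows "laplacian (E \<union> E') f v = laplacian E f v"
proof -
  have "hyperedges_at (E \<union> E') v = hyperedges_at E v"
    using assms by (auto simp: hyperedges_at_def)
  then show ?thesis
    by (simp add: laplacian_def)
qed

section \<open>Disjoint unions and complements\<close>

lemma laplacian_integral_no_hyperedges: "laplacian_integral r V {}"
  by (auto simp: laplacian_integral_def laplacian_eigenvalue_def laplacian_def hyperedges_at_def
      intro: exI[of _ 0])

lemma laplacian_integral_Un:
  assumes "laplacian_integral r V E" and "laplacian_integral r V' E'"
    and "E \<subseteq> Pow V" and "E' \<subseteq> Pow V'" and "V \<inter> V' = {}"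
  shows "laplacian_integral r (V \<union> V') (E \<union> E')"
  unfolding laplacian_integral_def
proof (intro allI impI)
  fix \<mu> assume "laplacian_eigenvalue (V \<union> V') (E \<union> E') \<mu>"
  then obtain f where nz: "\<exists>v\<in>V \<union> V'. f v \<noteq> 0"
    and ev: "\<forall>v\<in>V \<union> V'. laplacian (E \<union> E') f v = \<mu> * f v"
    by (auto simp: laplacian_eigenvalue_def)
  have "laplacian E f v = \<mu> * f v" if "v \<in> V" for v
  proof -
    have "laplacian (E \<union> E') f v = laplacian E f v"
      using that assms(4,5) by (intro laplacian_Un_not_incident) blast
    then show ?thesis
      using ev that by simp
  qed
  moreover have "laplacian E' f v = \<mu> * f v" if "v \<in> V'" for v
  proof -
    have "laplacian (E' \<union> E) f v = laplacian E' f v"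
      using that assms(3,5) by (intro laplacian_Un_not_incident) blast
    then show ?thesis
      using ev that by (simp add: Un_commute)
  qed
  ultimately have "laplacian_eigenvalue V E \<mu> \<or> laplacian_eigenvalue V' E' \<mu>"
    using nz unfolding laplacian_eigenvalue_def by blast
  then show "\<exists>p::int. \<mu> = r * of_int p"
    using assms(1,2) by (auto simp: laplacian_integral_def)
qed

lemma card_subsets_through_two:
  assumes "finite V" and "u \<in> V" and "v \<in> V" and "u \<noteq> v" and "0 < k"
  shows "card {e. e \<subseteq> V \<and> card e = k + 1 \<and> u \<in> e \<and> v \<in> e} = (card V - 2) choose (k - 1)"
proof -
  let ?W = "V - {u, v}"
  have fin: "finite e" if "e \<subseteq> V" for e
    using that assms(1) by (rule finite_subset)
  have "bij_betw (\<lambda>e. e - {u, v}) {e. e \<subseteq> V \<and> card e = k + 1 \<and> u \<in> e \<and> v \<in> e}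
          {d. d \<subseteq> ?W \<and> card d = k - 1}"
  proof (rule bij_betw_byWitness[where f' = "\<lambda>d. insert u (insert v d)"])
    show "(\<lambda>d. insert u (insert v d)) ` {d. d \<subseteq> ?W \<and> card d = k - 1}
        \<subseteq> {e. e \<subseteq> V \<and> card e = k + 1 \<and> u \<in> e \<and> v \<in> e}"
    proof
      fix e assume "e \<in> (\<lambda>d. insert u (insert v d)) ` {d. d \<subseteq> ?W \<and> card d = k - 1}"
      then obtain d where d: "e = insert u (insert v d)" "d \<subseteq> ?W" "card d = k - 1"
        by blast
      then have "finite d" "u \<notin> d" "v \<notin> d"
        using fin by auto
      then have "card e = k + 1"
        using d(1,3) assms(4,5) by simp
      then show "e \<in> {e. e \<subseteq> V \<and> card e = k + 1 \<and> u \<in> e \<and> v \<in> e}"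
        using d(1,2) assms(2,3) by blast
    qed
    show "(\<lambda>e. e - {u, v}) ` {e. e \<subseteq> V \<and> card e = k + 1 \<and> u \<in> e \<and> v \<in> e}
        \<subseteq> {d. d \<subseteq> ?W \<and> card d = k - 1}"
      using assms(4) fin by (auto simp: card_Diff_subset)
  qed auto
  then have "card {e. e \<subseteq> V \<and> card e = k + 1 \<and> u \<in> e \<and> v \<in> e}
      = card {d. d \<subseteq> ?W \<and> card d = k - 1}"
    by (rule bij_betw_same_card)
  also have "\<dots> = card ?W choose (k - 1)"
    using assms(1) by (intro n_subsets) simp
  also have "card ?W = card V - 2"
    using assms by (simp add: card_Diff_subset)
  finally show ?thesis .
qed

text \<open>
  Every pair of distinct vertices lies in the same number of hyperedges of the complete uniform
  hypergraph, so its Laplacian is a multiple of that of the complete graph.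
\<close>

lemma laplacian_complete_uniform:
  assumes "finite V" and "v \<in> V" and "0 < k"
  shows "laplacian {e. e \<subseteq> V \<and> card e = k + 1} f v
    = real ((card V - 2) choose (k - 1)) / real k * (real (card V) * f v - sum f V)"
proof -
  let ?N = "(card V - 2) choose (k - 1)"
  let ?K = "{e. e \<subseteq> V \<and> card e = k + 1 \<and> v \<in> e}"
  have finK: "finite ?K"
    using assms(1) by simp
  have at: "hyperedges_at {e. e \<subseteq> V \<and> card e = k + 1} v = ?K"
    by (auto simp: hyperedges_at_def)
  have "laplacian {e. e \<subseteq> V \<and> card e = k + 1} f v
      = (\<Sum>e\<in>?K. 1 / real k * (\<Sum>u\<in>e. f v - f u))"
    unfolding laplacian_def at by (intro sum.cong) auto
  also have "\<dots> = 1 / real k * (\<Sum>e\<in>?K. \<Sum>u\<in>e. f v - f u)"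
    by (simp add: sum_distrib_left)
  also have "(\<Sum>e\<in>?K. \<Sum>u\<in>e. f v - f u) = (\<Sum>e\<in>?K. \<Sum>u | u \<in> V \<and> u \<in> e. f v - f u)"
    by (intro sum.cong) auto
  also have "\<dots> = (\<Sum>u\<in>V. \<Sum>e | e \<in> ?K \<and> u \<in> e. f v - f u)"
    by (rule sum.swap_restrict[OF finK assms(1)])
  also have "\<dots> = (\<Sum>u\<in>V. real ?N * (f v - f u))"
  proof (rule sum.cong)
    fix u assume u: "u \<in> V"
    show "(\<Sum>e | e \<in> ?K \<and> u \<in> e. f v - f u) = real ?N * (f v - f u)"
    proof (cases "u = v")
      case False
      have "{e. e \<in> ?K \<and> u \<in> e} = {e. e \<subseteq> V \<and> card e = k + 1 \<and> u \<in> e \<and> v \<in> e}"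
        by auto
      then show ?thesis
        using card_subsets_through_two[OF assms(1) u assms(2) False assms(3)] by simp
    qed simp
  qed simp
  also have "\<dots> = real ?N * (real (card V) * f v - sum f V)"
    by (simp add: sum_distrib_left[symmetric] sum_subtractf)
  finally show ?thesis
    by simp
qed

text \<open>
  An eigenvector \<open>f\<close> of the complement with nonzero eigenvalue sums to zero, hence is also an
  eigenvector of the complete hypergraph, and so of the original one.
\<close>

lemma laplacian_integral_complement:
  assumes "laplacian_integral (1 / real k) V E" and "0 < k"
    and "finite V" and "E \<subseteq> Pow V" and "uniform (k + 1) E"
  shows "laplacian_integral (1 / real k) V (complement_hyperedges (k + 1) V E)"
  unfolding laplacian_integral_def
proof (intro allI impI)
  fix \<mu>
  let ?C = "complement_hyperedges (k + 1) V E"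
  let ?N = "(card V - 2) choose (k - 1)"
  assume "laplacian_eigenvalue V ?C \<mu>"
  then obtain f where nz: "\<exists>v\<in>V. f v \<noteq> 0" and ev: "\<forall>v\<in>V. laplacian ?C f v = \<mu> * f v"
    by (auto simp: laplacian_eigenvalue_def)
  have CV: "?C \<subseteq> Pow V"
    by (auto simp: complement_hyperedges_def)
  show "\<exists>p::int. \<mu> = 1 / real k * of_int p"
  proof (cases "\<mu> = 0")
    case True
    then show ?thesis
      by (intro exI[of _ 0]) simp
  next
    case False
    have sum0: "sum f V = 0"
      using eigenvector_sum_eq_0[OF assms(3) CV ev False] .
    have fin: "finite E" "finite ?C"
      using assms(3,4) CV finite_subset by (metis finite_Pow_iff)+
    have all: "E \<union> ?C = {e. e \<subseteq> V \<and> card e = k + 1}"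
      using assms(4,5) by (auto simp: complement_hyperedges_def uniform_def)
    have disj: "E \<inter> ?C = {}"
      by (auto simp: complement_hyperedges_def)
    have "laplacian E f v = (real ?N * real (card V) / real k - \<mu>) * f v" if "v \<in> V" for v
      using laplacian_Un_disjoint[OF fin disj, of f v]
        laplacian_complete_uniform[OF assms(3) that assms(2), of f] ev that unfolding all sum0 by (simp add: algebra_simps)
    then have "laplacian_eigenvalue V E (real ?N * real (card V) / real k - \<mu>)"
      using nz by (auto simp: laplacian_eigenvalue_def)
    then obtain q :: int where "real ?N * real (card V) / real k - \<mu> = 1 / real k * of_int q"
      using assms(1) by (auto simp: laplacian_integral_def)
    then have "\<mu> = 1 / real k * of_int (int ?N * int (card V) - q)"
      by (simp add: diff_divide_distrib)
    then show ?thesis ..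
  qed
qed

section \<open>Domination\<close>

lemma laplacian_domination_old:
  assumes "v \<in> V" and "S \<inter> V = {}" and "finite S" and "card S = k" and "0 < k"
  shows "laplacian {S \<union> {v} | v. v \<in> V} f v = f v - sum f S / real k"
proof -
  have at: "hyperedges_at {S \<union> {v} | v. v \<in> V} v = {insert v S}"
    using assms(1,2) by (auto simp: hyperedges_at_def)
  have "v \<notin> S"
    using assms(1,2) by auto
  then show ?thesis
    using assms(3-5) unfolding laplacian_def at by (simp add: sum_subtractf field_simps)
qed

lemma laplacian_domination_new:
  assumes "s \<in> S" and "S \<inter> V = {}" and "finite S" and "card S = k"
  shows "laplacian {S \<union> {v} | v. v \<in> V} f s
    = (real (card V) * ((real k + 1) * f s - sum f S) - sum f V) / real k"
proof -
  have at: "hyperedges_at {S \<union> {v} | v. v \<in> V} s = (\<lambda>v. insert v S) ` V"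
    using assms(1) by (auto simp: hyperedges_at_def)
  have inj: "inj_on (\<lambda>v. insert v S) V"
    using assms(2) by (auto simp: inj_on_def)
  have "laplacian {S \<union> {v} | v. v \<in> V} f s
      = (\<Sum>v\<in>V. 1 / (real (card (insert v S)) - 1) * (\<Sum>u\<in>insert v S. f s - f u))"
    unfolding laplacian_def at by (simp add: sum.reindex[OF inj])
  also have "\<dots> = (\<Sum>v\<in>V. ((real k + 1) * f s - sum f S - f v) / real k)"
  proof (rule sum.cong)
    fix v assume "v \<in> V"
    then have "v \<notin> S"
      using assms(2) by auto
    then show "1 / (real (card (insert v S)) - 1) * (\<Sum>u\<in>insert v S. f s - f u)
        = ((real k + 1) * f s - sum f S - f v) / real k"
      using assms(3,4) by (simp add: sum_subtractf distrib_right)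
  qed simp
  also have "\<dots> = (real (card V) * ((real k + 1) * f s - sum f S) - sum f V) / real k"
    by (simp add: sum_divide_distrib[symmetric] sum_subtractf)
  finally show ?thesis .
qed

text \<open>
  The new hyperedges couple the two vertex sets only through the sums of \<open>f\<close> over \<open>V\<close> and \<open>S\<close>.
  For a nonzero eigenvalue these sums are opposite, so either they are nonzero and determine
  the eigenvalue, or both vanish and the equations on \<open>V\<close> and \<open>S\<close> are independent.
\<close>

lemma laplacian_integral_domination:
  assumes "laplacian_integral (1 / real k) V E" and "0 < k"
    and "finite V" and "E \<subseteq> Pow V" and "finite S" and "card S = k" and "S \<inter> V = {}"
  shows "laplacian_integral (1 / real k) (V \<union> S) (E \<union> {S \<union> {v} | v. v \<in> V})"
  unfolding laplacian_integral_def
proof (intro allI impI)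
  fix \<mu>
  let ?D = "{S \<union> {v} | v. v \<in> V}"
  define n where "n = card V"
  assume "laplacian_eigenvalue (V \<union> S) (E \<union> ?D) \<mu>"
  then obtain f where nz: "\<exists>v\<in>V \<union> S. f v \<noteq> 0"
    and ev: "\<forall>v\<in>V \<union> S. laplacian (E \<union> ?D) f v = \<mu> * f v"
    by (auto simp: laplacian_eigenvalue_def)
  have "S \<noteq> {}"
    using assms(2,6) by auto
  have fin: "finite E" "finite ?D"
    using assms(3,4) finite_subset by auto
  have disj: "E \<inter> ?D = {}"
    using assms(4,7) \<open>S \<noteq> {}\<close> by blast
  have old: "\<mu> * f v = laplacian E f v + f v - sum f S / real k" if "v \<in> V" for v
    using ev that laplacian_Un_disjoint[OF fin disj, of f v]
      laplacian_domination_old[OF that assms(7,5,6,2), of f] by simp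
  have new: "\<mu> * f s = (real n * ((real k + 1) * f s - sum f S) - sum f V) / real k"
    if "s \<in> S" for s
  proof -
    have "laplacian (?D \<union> E) f s = laplacian ?D f s"
      using assms(4,7) that by (intro laplacian_Un_not_incident) blast
    then show ?thesis
      using ev that laplacian_domination_new[OF that assms(7,5,6), of f]
      by (simp add: n_def Un_commute)
  qed
  show "\<exists>p::int. \<mu> = 1 / real k * of_int p"
  proof (cases "\<mu> = 0")
    case True
    then show ?thesis
      by (intro exI[of _ 0]) simp
  next
    case False
    have "E \<union> ?D \<subseteq> Pow (V \<union> S)"
      using assms(4) by auto
    then have "sum f (V \<union> S) = 0"
      using eigenvector_sum_eq_0[OF _ _ ev False] assms(3,5) by simp
    then have opp: "sum f V = - sum f S"
      using assms(3,5,7) by (simp add: sum.union_disjoint Int_commute)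
    have "\<mu> * sum f S = (\<Sum>s\<in>S. (real n * ((real k + 1) * f s - sum f S) - sum f V) / real k)"
      using new by (simp add: sum_distrib_left)
    also have "\<dots> = (real n * ((real k + 1) * sum f S - real k * sum f S) - real k * sum f V) / real k"
      using assms(6)
      by (simp add: sum_divide_distrib[symmetric] sum_subtractf sum_distrib_left[symmetric])
    also have "\<dots> = (1 + real n / real k) * sum f S"
      using assms(2) by (simp add: opp field_simps)
    finally have S_eq: "\<mu> * sum f S = (1 + real n / real k) * sum f S" .
    show ?thesis
    proof (cases "sum f S = 0")
      case False
      then have "\<mu> = 1 + real n / real k"
        using S_eq by simp
      then have "\<mu> = 1 / real k * of_int (int k + int n)"
        using assms(2) by (simp add: field_simps)
      then show ?thesis ..
    next
      case True
      then have V0: "sum f V = 0"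
        using opp by simp
      show ?thesis
      proof (cases "\<exists>s\<in>S. f s \<noteq> 0")
        case True
        then obtain s where s: "s \<in> S" "f s \<noteq> 0"
          by blast
        then have "\<mu> * f s = (real n * (real k + 1) / real k) * f s"
          using new \<open>sum f S = 0\<close> V0 by simp
        then have "\<mu> = real n * (real k + 1) / real k"
          using s(2) by (simp only: mult_cancel_right) simp
        then have "\<mu> = 1 / real k * of_int (int n * (int k + 1))"
          by simp
        then show ?thesis ..
      next
        case False
        then have "\<exists>v\<in>V. f v \<noteq> 0"
          using nz by blast
        moreover have "laplacian E f v = (\<mu> - 1) * f v" if "v \<in> V" for v
          using old[OF that] \<open>sum f S = 0\<close> by (simp add: algebra_simps)
        ultimately have "laplacian_eigenvalue V E (\<mu> - 1)"
          by (auto simp: laplacian_eigenvalue_def)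
        then obtain q :: int where "\<mu> - 1 = 1 / real k * of_int q"
          using assms(1) by (auto simp: laplacian_integral_def)
        then have "\<mu> = 1 / real k * of_int (int k + q)"
          using assms(2) by (simp add: field_simps)
        then show ?thesis ..
      qed
    qed
  qed
qed

section \<open>Integrality of threshold and co-threshold hypergraphs\<close>

lemma threshold_laplacian_integral:
  assumes "threshold_hypergraph k V E" and "0 < k"
  shows "laplacian_integral (1 / real k) V E"
  using assms
proof (induction rule: threshold_hypergraph.induct)
  case (single v)
  show ?case
    by (rule laplacian_integral_no_hyperedges)
next
  case (isolated V E v)
  then have "E \<subseteq> Pow V"
    using threshold_hypergraph_wf[of k V E] by (auto simp: hypergraph_def)
  then have "laplacian_integral (1 / real k) (V \<union> {v}) (E \<union> {})"
    using isolated by (intro laplacian_integral_Un laplacian_integral_no_hyperedges) auto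
  then show ?case
    by simp
next
  case (domination V E S)
  then have "finite V" "E \<subseteq> Pow V"
    using threshold_hypergraph_wf[of k V E] by (auto simp: hypergraph_def)
  then show ?case
    using domination by (intro laplacian_integral_domination) auto
qed

lemma co_threshold_laplacian_integral:
  assumes "co_threshold_hypergraph k V E" and "0 < k"
  shows "laplacian_integral (1 / real k) V E"
  using assms
proof (induction rule: co_threshold_hypergraph.induct)
  case (threshold V E)
  then show ?case
    by (rule threshold_laplacian_integral)
next
  case (complement V E)
  then have "finite V" "E \<subseteq> Pow V" "uniform (k + 1) E"
    using co_threshold_hypergraph_wf[of k V E] by (auto simp: hypergraph_def)
  then show ?case
    using complement by (intro laplacian_integral_complement) auto
next
  case (union V E V' E')
  then have "E \<subseteq> Pow V" "E' \<subseteq> Pow V'"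
    using co_threshold_hypergraph_wf[of k V E] co_threshold_hypergraph_wf[of k V' E']
    by (auto simp: hypergraph_def)
  then show ?case
    using union by (intro laplacian_integral_Un) auto
qed

theorem theorem3p3:
  fixes k :: nat and V :: "'a set" and E :: "'a set set"
  assumes "0 < k"
    and "co_threshold_hypergraph k V E"
  shows "\<exists>r\<in>\<rat>. laplacian_integral r V E"
proof
  show "laplacian_integral (1 / real k) V E"
    using assms(2,1) by (rule co_threshold_laplacian_integral)
  show "1 / real k \<in> \<rat>"
    by simp
qed

end
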